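(* Let $m,n\ge 2$ be integers and let $\phi: M_{mn}\to M_{mn}$ be a (complex-)linear map. Let $\|\cdot\|$ denote the spectral norm on $M_{mn}$. The following are equivalent. (a) $\|\phi(A\otimes B)\| = \|A\otimes B\|$ for all $A\in M_m$ and $B\in M_n$. (b) There are unitary matrices $U,V\in M_{mn}$, and maps $\varphi_1: M_m\to M_m$, $\varphi_2: M_n\to M_n$, where each $\varphi_s$ ($s=1,2$) is either the identity map $X\mapsto X$ or the transposition map $X\mapsto X^t$, such that $$\phi(A\otimes B)=U(\varphi_1(A)\otimes\varphi_2(B))V\quad\text{for all } A\in M_m \text{ and } B\in M_n.$$
   Context: $M_n$ denotes the set of $n\times n$ complex matrices. For $A\in M_m$, $B\in M_n$, $A\otimes B\in M_{mn}$ is the tensor (Kronecker) product. The spectral norm of a matrix is its largest singular value. $X^t$ is the transpose of $X$ (without conjugation). *)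

theory Defs
  imports "HOL-Analysis.Analysis"
begin

text \<open>
  An \<open>n \<times> n\<close> complex matrix is an element of \<^typ>\<open>complex^'n^'n\<close> with \<open>n = CARD('n)\<close>.
  The rows and columns of a matrix of size \<open>m n\<close> are indexed by pairs, i.e. by
  \<^typ>\<open>'m \<times> 'n\<close>: for the lexicographic order of the pairs, \<open>kron A B\<close> is the block matrix
  whose block in position \<open>(i, j)\<close> is \<open>A $ i $ j\<close> times \<open>B\<close>.
\<close>

definition kron :: "complex^'a^'b \<Rightarrow> complex^'c^'d \<Rightarrow> complex^('a \<times> 'c)^('b \<times> 'd)"  (infixl \<open>\<otimes>\<^sub>K\<close> 72)
  where "A \<otimes>\<^sub>K B = (\<chi> p q. A $ fst p $ fst q * B $ snd p $ snd q)"

definition cmat_scale :: "complex \<Rightarrow> complex^'n^'m \<Rightarrow> complex^'n^'m"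
  where "cmat_scale c A = (\<chi> i j. c * A $ i $ j)"

text \<open>
  The predicate \<open>linear\<close> of the analysis library means real linearity.
\<close>

definition complex_linear :: "(complex^'n^'m \<Rightarrow> complex^'l^'k) \<Rightarrow> bool"
  where "complex_linear f \<longleftrightarrow> Vector_Spaces.linear cmat_scale cmat_scale f"

lemma vector_space_cmat_scale: "vector_space cmat_scale"
  by unfold_locales (simp_all add: cmat_scale_def vec_eq_iff algebra_simps)

lemma complex_linear_iff:
  "complex_linear f \<longleftrightarrow>
    (\<forall>A B. f (A + B) = f A + f B) \<and> (\<forall>c A. f (cmat_scale c A) = cmat_scale c (f A))"
  unfolding complex_linear_def
  by (auto simp: Vector_Spaces.linear_def module_hom_def module_hom_axioms_def
      vector_space_cmat_scale module_iff_vector_space)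

definition conj_transpose :: "complex^'n^'m \<Rightarrow> complex^'m^'n"
  where "conj_transpose A = (\<chi> i j. cnj (A $ j $ i))"

definition unitary_matrix :: "complex^'n^'n \<Rightarrow> bool"
  where "unitary_matrix U \<longleftrightarrow>
    conj_transpose U ** U = mat 1 \<and> U ** conj_transpose U = mat 1"

definition matrix_eigenvalue :: "complex^'n^'n \<Rightarrow> complex \<Rightarrow> bool"
  where "matrix_eigenvalue A k \<longleftrightarrow> (\<exists>v. v \<noteq> 0 \<and> A *v v = k *s v)"

definition singular_value :: "complex^'n^'m \<Rightarrow> real \<Rightarrow> bool"
  where "singular_value A s \<longleftrightarrow>
    0 \<le> s \<and> matrix_eigenvalue (conj_transpose A ** A) (complex_of_real (s\<^sup>2))"

text \<open>
  \<open>Greatest\<close> is unspecified when there is no greatest element; the lemmas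
  \<open>singular_value_spectral_norm\<close> and \<open>singular_value_le_spectral_norm\<close> below show that a
  largest singular value always exists.
\<close>

definition spectral_norm :: "complex^'n^'m \<Rightarrow> real"
  where "spectral_norm A = (GREATEST s. singular_value A s)"

definition cdot :: "complex^'n \<Rightarrow> complex^'n \<Rightarrow> complex"
  where "cdot x y = (\<Sum>i\<in>UNIV. cnj (x $ i) * y $ i)"

lemma cdot_self: "cdot x x = complex_of_real ((norm x)\<^sup>2)"
  unfolding cdot_def norm_vec_def L2_set_def
  by (simp add: sum_nonneg complex_norm_square mult.commute flip: of_real_power)

lemma inner_eq_Re_cdot: "x \<bullet> y = Re (cdot x y)"
  by (simp add: cdot_def inner_vec_def inner_complex_def)

lemma cdot_adjoint: "cdot x (A *v y) = cdot (conj_transpose A *v x) y"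
proof -
  have "cdot x (A *v y) = (\<Sum>i\<in>UNIV. \<Sum>j\<in>UNIV. cnj (x $ i) * A $ i $ j * y $ j)"
    by (simp add: cdot_def matrix_vector_mult_def sum_distrib_left mult.assoc)
  also have "\<dots> = (\<Sum>j\<in>UNIV. \<Sum>i\<in>UNIV. cnj (x $ i) * A $ i $ j * y $ j)"
    by (rule sum.swap)
  also have "\<dots> = cdot (conj_transpose A *v x) y"
    by (simp add: cdot_def matrix_vector_mult_def conj_transpose_def sum_distrib_right
        sum_distrib_left mult_ac)
  finally show ?thesis .
qed

lemma conj_transpose_conj_transpose [simp]: "conj_transpose (conj_transpose A) = A"
  by (simp add: conj_transpose_def vec_eq_iff)

lemma linear_matrix_vector_mult_complex: "linear ((*v) (A :: complex^'n^'m))"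
  by (rule linearI)
     (simp_all add: matrix_vector_right_distrib vec_eq_iff matrix_vector_mult_def
       scaleR_sum_right algebra_simps sum.distrib)

lemma inner_gram: "v \<bullet> ((conj_transpose A ** A) *v v) = (norm (A *v v))\<^sup>2"
proof -
  have "cdot v ((conj_transpose A ** A) *v v) = cdot (A *v v) (A *v v)"
    by (simp add: cdot_adjoint flip: matrix_vector_mul_assoc)
  then show ?thesis
    by (simp add: inner_eq_Re_cdot cdot_self flip: of_real_power)
qed

lemma norm_eq_of_singular_value:
  assumes "matrix_eigenvalue (conj_transpose A ** A) (complex_of_real (s\<^sup>2))" "0 \<le> s"
  shows "\<exists>v. v \<noteq> 0 \<and> norm (A *v v) = s * norm v"
proof -
  obtain v where v: "v \<noteq> 0"
      "(conj_transpose A ** A) *v v = complex_of_real (s\<^sup>2) *s v"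
    using assms(1) by (auto simp: matrix_eigenvalue_def)
  have "complex_of_real (s\<^sup>2) *s v = s\<^sup>2 *\<^sub>R v"
    by (simp add: vec_eq_iff scaleR_conv_of_real[where 'a=complex] flip: of_real_power)
  with v have "(norm (A *v v))\<^sup>2 = (s * norm v)\<^sup>2"
    using inner_gram [of v A] by (simp add: power_mult_distrib dot_square_norm)
  then have "norm (A *v v) = s * norm v"
    using assms(2) by (simp add: power2_eq_iff_nonneg)
  with v show ?thesis by blast
qed

lemma onorm_singular_value: "singular_value A (onorm ((*v) A))"
proof -
  define M where "M = onorm ((*v) A)"
  have bl: "bounded_linear ((*v) A)"
    using linear_matrix_vector_mult_complex linear_conv_bounded_linear by blast
  have le: "norm (A *v x) \<le> M * norm x" for x
    unfolding M_def by (rule onorm [OF bl])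
  have M0: "0 \<le> M"
    unfolding M_def by (rule onorm_pos_le [OF bl])
  have "continuous_on (sphere 0 1) (\<lambda>x. norm (A *v x))"
    by (intro continuous_on_norm linear_continuous_on bl)
  moreover have "axis undefined 1 \<in> sphere (0 :: complex^'n) 1"
    by (simp add: norm_axis_1)
  ultimately obtain u where u: "norm u = 1" and max: "\<And>y. norm y = 1 \<Longrightarrow> norm (A *v y) \<le> norm (A *v u)"
    using continuous_attains_sup [OF compact_sphere, of 0 1 "\<lambda>x. norm (A *v x)"] by fastforce
  have "norm (A *v x) \<le> norm (A *v u) * norm x" for x
  proof (cases "x = 0")
    case False
    have "norm (A *v (x /\<^sub>R norm x)) \<le> norm (A *v u)"
      using False by (intro max) simp
    moreover have "A *v (x /\<^sub>R norm x) = (A *v x) /\<^sub>R norm x"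
      using linear_matrix_vector_mult_complex linear_scale by blast
    ultimately show ?thesis
      using False by (simp add: field_simps)
  qed simp
  then have "M \<le> norm (A *v u)"
    unfolding M_def by (intro onorm_bound) auto
  with le [of u] u have Mu: "norm (A *v u) = M"
    by simp
  define w where "w = (conj_transpose A ** A) *v u"
  have w: "w = conj_transpose A *v (A *v u)"
    by (simp add: w_def matrix_vector_mul_assoc)
  have "(norm w)\<^sup>2 = Re (cdot w w)"
    by (simp add: cdot_self flip: of_real_power)
  also have "cdot w w = cdot (A *v w) (A *v u)"
    by (subst (2) w) (simp add: cdot_adjoint)
  also have "Re \<dots> = (A *v w) \<bullet> (A *v u)"
    by (simp add: inner_eq_Re_cdot)
  also have "\<dots> \<le> norm (A *v w) * norm (A *v u)"
    by (rule norm_cauchy_schwarz)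
  also have "\<dots> \<le> M * norm w * M"
    using le [of w] M0 Mu by (simp add: mult_right_mono)
  finally have "norm w * norm w \<le> M\<^sup>2 * norm w"
    by (simp add: power2_eq_square mult_ac)
  then have wle: "norm w \<le> M\<^sup>2"
    by (cases "w = 0") auto
  have uw: "u \<bullet> w = M\<^sup>2"
    using inner_gram [of u A] Mu by (simp add: w_def)
  have "(norm (w - M\<^sup>2 *\<^sub>R u))\<^sup>2 = (norm w)\<^sup>2 - 2 * M\<^sup>2 * (u \<bullet> w) + (M\<^sup>2)\<^sup>2 * (norm u)\<^sup>2"
    unfolding power2_norm_eq_inner
    by (simp add: inner_diff inner_commute algebra_simps power2_eq_square)
  also have "\<dots> = (norm w)\<^sup>2 - (M\<^sup>2)\<^sup>2"
    using u uw by (simp add: power2_eq_square)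
  also have "\<dots> \<le> 0"
    using wle power_mono [of "norm w" "M\<^sup>2" 2] by simp
  finally have "w = M\<^sup>2 *\<^sub>R u"
    by simp
  then have "(conj_transpose A ** A) *v u = complex_of_real (M\<^sup>2) *s u"
    by (simp add: w_def vec_eq_iff scaleR_conv_of_real[where 'a=complex] flip: of_real_power)
  moreover have "u \<noteq> 0"
    using u by auto
  ultimately show ?thesis
    using M0 unfolding singular_value_def matrix_eigenvalue_def M_def by blast
qed

lemma singular_value_le_onorm:
  assumes "singular_value A s"
  shows "s \<le> onorm ((*v) A)"
proof -
  have bl: "bounded_linear ((*v) A)"
    using linear_matrix_vector_mult_complex linear_conv_bounded_linear by blast
  obtain v where "v \<noteq> 0" "norm (A *v v) = s * norm v"
    using assms norm_eq_of_singular_value by (auto simp: singular_value_def)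
  with onorm [OF bl, of v] show ?thesis
    by simp
qed

lemma spectral_norm_eq_onorm: "spectral_norm A = onorm ((*v) A)"
  unfolding spectral_norm_def
  by (rule Greatest_equality) (simp_all add: onorm_singular_value singular_value_le_onorm)

lemma singular_value_spectral_norm: "singular_value A (spectral_norm A)"
  by (simp add: spectral_norm_eq_onorm onorm_singular_value)

lemma singular_value_le_spectral_norm: "singular_value A s \<Longrightarrow> s \<le> spectral_norm A"
  by (simp add: spectral_norm_eq_onorm singular_value_le_onorm)

end

theory Submission
  imports Defs
begin

text \<open>
  Norming vectors \<open>x\<^sub>i\<^sub>j\<close> of the matrices \<open>\<phi> (E\<^sub>i\<^sub>i \<otimes> E\<^sub>j\<^sub>j)\<close> are annihilated by all the other
  \<open>\<phi> (E\<^sub>k\<^sub>k \<otimes> E\<^sub>l\<^sub>l)\<close>, because \<open>\<phi>\<close> preserves the norm of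
  \<open>(E\<^sub>i\<^sub>i \<plusminus> E\<^sub>k\<^sub>k) \<otimes> (E\<^sub>j\<^sub>j \<plusminus> E\<^sub>l\<^sub>l)\<close>. Hence the \<open>m n\<close> vectors \<open>x\<^sub>i\<^sub>j\<close> are linearly independent, and
  each \<open>\<phi> (E\<^sub>i\<^sub>i \<otimes> E\<^sub>j\<^sub>j)\<close> has rank one; the norm condition then makes both the \<open>x\<^sub>i\<^sub>j\<close> and
  their images orthonormal. The same holds for any choice of orthonormal bases, so \<open>\<phi>\<close> maps
  products of rank-one matrices to matrices of rank one. After unitary changes of bases
  \<open>\<phi>\<close> fixes all \<open>E\<^sub>i\<^sub>i \<otimes> E\<^sub>j\<^sub>j\<close>, and the vanishing of the \<open>2 \<times> 2\<close> minors of the images of sums of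
  matrix units locates the nonzero entries of every \<open>\<phi> (E\<^sub>i\<^sub>k \<otimes> E\<^sub>j\<^sub>l)\<close>, up to one global
  transposition in each factor. The remaining unimodular coefficients form a matrix of rank
  one, namely the image of the product of the all-ones matrices, and are absorbed by diagonal
  unitary matrices.
\<close>

section \<open>Spectral norm\<close>

lemma norm_le_spectral_norm: "norm (A *v x) \<le> spectral_norm A * norm x"
  for A :: "complex^'n^'m"
  unfolding spectral_norm_eq_onorm
  using linear_matrix_vector_mult_complex linear_conv_bounded_linear by (blast intro: onorm)

lemma spectral_norm_attained:
  fixes A :: "complex^'n^'m"
  obtains x where "norm x = 1" "norm (A *v x) = spectral_norm A"
proof -
  obtain v where v: "v \<noteq> 0" "norm (A *v v) = spectral_norm A * norm v"
    using norm_eq_of_singular_value singular_value_spectral_norm singular_value_def by metis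
  have "A *v (v /\<^sub>R norm v) = (A *v v) /\<^sub>R norm v"
    using linear_matrix_vector_mult_complex linear_scale by blast
  with v that[of "v /\<^sub>R norm v"] show ?thesis
    by simp
qed

lemma spectral_norm_nonneg: "0 \<le> spectral_norm A"
  by (metis norm_ge_zero spectral_norm_attained)

lemma spectral_norm_leI: "(\<And>x. norm (A *v x) \<le> b * norm x) \<Longrightarrow> spectral_norm A \<le> b"
  by (metis spectral_norm_attained mult.right_neutral)

lemma spectral_norm_0 [simp]: "spectral_norm 0 = 0"
  by (metis spectral_norm_attained matrix_vector_mult_0 norm_zero)

lemma spectral_norm_cong:
  fixes A :: "complex^'n^'m" and B :: "complex^'n^'l"
  assumes "\<And>x. norm (A *v x) = norm (B *v x)"
  shows "spectral_norm A = spectral_norm B"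
  by (intro antisym spectral_norm_leI) (metis assms norm_le_spectral_norm)+

section \<open>Unitary matrices and invariance of the spectral norm\<close>

lemma unitary_matrix_conj_transpose: "unitary_matrix U \<Longrightarrow> unitary_matrix (conj_transpose U)"
  by (simp add: unitary_matrix_def)

lemma conj_transpose_mult: "conj_transpose (A ** B) = conj_transpose B ** conj_transpose A"
  by (simp add: conj_transpose_def matrix_matrix_mult_def vec_eq_iff mult.commute)

lemma conj_transpose_mat_1 [simp]: "conj_transpose (mat 1) = mat 1"
  by (auto simp: conj_transpose_def mat_def vec_eq_iff)

lemma unitary_matrix_mat_1: "unitary_matrix (mat 1)"
  by (simp add: unitary_matrix_def)

lemma unitary_matrix_mult:
  assumes "unitary_matrix U" "unitary_matrix V"
  shows "unitary_matrix (U ** V)"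
proof -
  have "conj_transpose V ** conj_transpose U ** (U ** V) = conj_transpose V ** (conj_transpose U ** U) ** V"
    "U ** V ** (conj_transpose V ** conj_transpose U) = U ** (V ** conj_transpose V) ** conj_transpose U"
    by (simp_all add: matrix_mul_assoc)
  with assms show ?thesis
    by (simp add: unitary_matrix_def conj_transpose_mult)
qed

lemma unitary_matrixI: "conj_transpose U ** U = mat 1 \<Longrightarrow> unitary_matrix U"
  for U :: "complex^'n^'n"
  unfolding unitary_matrix_def by (metis matrix_left_right_inverse)

lemma unitary_matrix_transpose:
  assumes "unitary_matrix U"
  shows "unitary_matrix (transpose U)"
proof -
  \<comment> \<open>Entrywise conjugation of \<open>U ** conj_transpose U = mat 1\<close> is the
    identity required of \<open>transpose U\<close>.\<close>
  have "(\<chi> i j. cnj ((U ** conj_transpose U) $ i $ j)) = mat 1"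
    using assms by (auto simp: unitary_matrix_def mat_def vec_eq_iff)
  then show ?thesis
    by (intro unitary_matrixI)
       (simp add: conj_transpose_def matrix_matrix_mult_def transpose_def vec_eq_iff mult.commute)
qed

lemma norm_unitary_mult:
  assumes "unitary_matrix U"
  shows "norm (U *v x) = norm x"
  using inner_gram[of x U] assms
  by (simp add: unitary_matrix_def power2_norm_eq_inner[symmetric])

text \<open>One inequality, valid for every unitary factor, suffices, because a second unitary
  factor recovers \<open>A\<close> from \<open>A ** V\<close>.\<close>

lemma spectral_norm_mult_unitary:
  fixes A :: "complex^'n^'m"
  assumes "unitary_matrix V"
  shows "spectral_norm (A ** V) = spectral_norm A"
proof -
  have le: "spectral_norm (A ** V) \<le> spectral_norm A" if "unitary_matrix V" for A :: "complex^'n^'m" and V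
    by (intro spectral_norm_leI)
       (metis norm_le_spectral_norm matrix_vector_mul_assoc norm_unitary_mult that)
  have "A = (A ** V) ** conj_transpose V"
    using assms by (simp add: unitary_matrix_def flip: matrix_mul_assoc)
  then show ?thesis
    by (metis antisym assms le unitary_matrix_conj_transpose)
qed

lemma spectral_norm_unitary:
  assumes "unitary_matrix U" "unitary_matrix V"
  shows "spectral_norm (U ** A ** V) = spectral_norm A"
proof -
  have "spectral_norm (U ** A ** V) = spectral_norm (A ** V)"
    by (intro spectral_norm_cong)
       (simp add: norm_unitary_mult[OF assms(1)] flip: matrix_vector_mul_assoc)
  with assms show ?thesis
    by (simp add: spectral_norm_mult_unitary)
qed

section \<open>Cauchy-Schwarz inequality, adjoints and transposes\<close>

lemma norm_cdot_le: "cmod (cdot x y) \<le> norm x * norm y"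
proof -
  have "cmod (cdot x y) \<le> (\<Sum>i\<in>UNIV. \<bar>cmod (x $ i)\<bar> * \<bar>cmod (y $ i)\<bar>)"
    unfolding cdot_def by (rule order_trans[OF norm_sum]) (simp add: norm_mult)
  also have "\<dots> \<le> norm x * norm y"
    unfolding norm_vec_def by (rule L2_set_mult_ineq)
  finally show ?thesis .
qed

text \<open>Moving the adjoint across \<open>cdot\<close> gives |A* x|^2 = |<x, A A* x>|, and
  Cauchy-Schwarz leaves one factor |A* x| to cancel.\<close>

lemma spectral_norm_conj_transpose_le: "spectral_norm (conj_transpose A) \<le> spectral_norm A"
proof (rule spectral_norm_leI)
  fix x
  let ?y = "conj_transpose A *v x"
  have "norm ?y * norm ?y = cmod (cdot ?y ?y)"
    by (simp add: cdot_self norm_power power2_eq_square norm_mult)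
  also have "\<dots> = cmod (cdot x (A *v ?y))"
    by (simp add: cdot_adjoint)
  also have "\<dots> \<le> norm x * (spectral_norm A * norm ?y)"
    by (intro order_trans[OF norm_cdot_le] mult_left_mono norm_le_spectral_norm) simp
  finally have "norm ?y * norm ?y \<le> (spectral_norm A * norm x) * norm ?y"
    by (simp add: mult_ac)
  then show "norm ?y \<le> spectral_norm A * norm x"
    by (cases "?y = 0") (auto simp: spectral_norm_nonneg)
qed

lemma spectral_norm_conj_transpose: "spectral_norm (conj_transpose A) = spectral_norm A"
  by (metis antisym spectral_norm_conj_transpose_le conj_transpose_conj_transpose)

text \<open>Conjugating all entries of \<open>A\<close> amounts to composing \<open>A\<close> on
  both sides with the coordinatewise conjugation of vectors, which preserves norms.\<close>

lemma spectral_norm_cnj_le: "spectral_norm (\<chi> i j. cnj (A $ i $ j)) \<le> spectral_norm A"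
proof (rule spectral_norm_leI)
  fix x
  let ?c = "\<lambda>x. \<chi> i. cnj (x $ i)"
  have "(\<chi> i j. cnj (A $ i $ j)) *v x = ?c (A *v ?c x)"
    by (simp add: matrix_vector_mult_def vec_eq_iff)
  moreover have "norm (?c y) = norm y" for y :: "complex^'k"
    by (simp add: norm_vec_def)
  ultimately show "norm ((\<chi> i j. cnj (A $ i $ j)) *v x) \<le> spectral_norm A * norm x"
    by (metis norm_le_spectral_norm)
qed

lemma spectral_norm_transpose: "spectral_norm (transpose A) = spectral_norm A"
proof -
  have eq: "transpose A = (\<chi> i j. cnj (conj_transpose A $ i $ j))"
      "conj_transpose A = (\<chi> i j. cnj (transpose A $ i $ j))"
    by (simp_all add: conj_transpose_def transpose_def)
  have "spectral_norm (transpose A) \<le> spectral_norm (conj_transpose A)"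
    by (subst eq(1)) (rule spectral_norm_cnj_le)
  moreover have "spectral_norm (conj_transpose A) \<le> spectral_norm (transpose A)"
    by (subst eq(2)) (rule spectral_norm_cnj_le)
  ultimately show ?thesis
    by (simp add: spectral_norm_conj_transpose)
qed

section \<open>Multiplicativity of the norm on Kronecker products\<close>

lemma sum_prod_UNIV: "(\<Sum>p\<in>UNIV. f p) = (\<Sum>i\<in>UNIV. \<Sum>j\<in>UNIV. f (i, j))"
  by (simp add: sum.cartesian_product flip: UNIV_Times_UNIV)

lemma norm_vec_power2: "(norm x)\<^sup>2 = (\<Sum>i\<in>UNIV. (cmod (x $ i))\<^sup>2)"
  by (simp add: norm_vec_def L2_set_def sum_nonneg)

text \<open>The product acts in two stages: \<open>B\<close> on each slice of \<open>x\<close> with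
  fixed first index, giving \<open>y k\<close>, then \<open>A\<close> on the slices with fixed
  second index. Each stage is estimated by summing squared norms over slices.\<close>

lemma spectral_norm_kron_le:
  fixes A :: "complex^'a^'b" and B :: "complex^'c^'d"
  shows "spectral_norm (A \<otimes>\<^sub>K B) \<le> spectral_norm A * spectral_norm B"
proof (rule spectral_norm_leI)
  fix x :: "complex^('a \<times> 'c)"
  define y where "y = (\<lambda>k. B *v (\<chi> l. x $ (k, l)))"
  have nn: "0 \<le> spectral_norm A" "0 \<le> spectral_norm B"
    by (simp_all add: spectral_norm_nonneg)
  have "(A \<otimes>\<^sub>K B *v x) $ (i, j) = (A *v (\<chi> k. y k $ j)) $ i" for i j
    by (simp add: y_def kron_def matrix_vector_mult_def sum_prod_UNIV sum_distrib_left mult_ac)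
  then have "(norm (A \<otimes>\<^sub>K B *v x))\<^sup>2 = (\<Sum>j\<in>UNIV. (norm (A *v (\<chi> k. y k $ j)))\<^sup>2)"
    by (simp add: norm_vec_power2 sum_prod_UNIV) (rule sum.swap)
  also have "\<dots> \<le> (\<Sum>j\<in>UNIV. (spectral_norm A * norm (\<chi> k. y k $ j))\<^sup>2)"
    by (intro sum_mono power_mono norm_le_spectral_norm) simp
  also have "\<dots> = (spectral_norm A)\<^sup>2 * (\<Sum>k\<in>UNIV. (norm (y k))\<^sup>2)"
    by (simp add: power_mult_distrib norm_vec_power2 flip: sum_distrib_left) (rule disjI2, rule sum.swap)
  also have "\<dots> \<le> (spectral_norm A)\<^sup>2 * (\<Sum>k\<in>UNIV. (spectral_norm B * norm (\<chi> l. x $ (k, l)))\<^sup>2)"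
    unfolding y_def by (intro sum_mono power_mono mult_left_mono norm_le_spectral_norm) simp_all
  also have "\<dots> = (spectral_norm A * spectral_norm B * norm x)\<^sup>2"
    by (simp add: power_mult_distrib norm_vec_power2 sum_prod_UNIV mult.assoc flip: sum_distrib_left)
  finally show "norm (A \<otimes>\<^sub>K B *v x) \<le> spectral_norm A * spectral_norm B * norm x"
    using nn by (auto intro: power2_le_imp_le)
qed

lemma spectral_norm_kron: "spectral_norm (A \<otimes>\<^sub>K B) = spectral_norm A * spectral_norm B"
  for A :: "complex^'a^'b" and B :: "complex^'c^'d"
proof (rule antisym[OF spectral_norm_kron_le])
  obtain x where x: "norm x = 1" "norm (A *v x) = spectral_norm A"
    by (rule spectral_norm_attained)
  obtain y where y: "norm y = 1" "norm (B *v y) = spectral_norm B"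
    by (rule spectral_norm_attained)
  have norm_prod: "norm (\<chi> p. u $ fst p * v $ snd p) = norm u * norm v" for u :: "complex^'k" and v :: "complex^'l"
  proof -
    have "(norm (\<chi> p. u $ fst p * v $ snd p))\<^sup>2 = (norm u * norm v)\<^sup>2"
      by (simp add: norm_vec_power2 power_mult_distrib sum_prod_UNIV norm_mult sum_product)
    then show ?thesis
      by simp
  qed
  \<comment> \<open>The product of norming vectors attains the upper bound.\<close>
  let ?z = "\<chi> p. x $ fst p * y $ snd p"
  have "A \<otimes>\<^sub>K B *v ?z = (\<chi> p. (A *v x) $ fst p * (B *v y) $ snd p)"
    by (simp add: kron_def matrix_vector_mult_def vec_eq_iff sum_prod_UNIV sum_product mult_ac)
  then have "norm (A \<otimes>\<^sub>K B *v ?z) = spectral_norm A * spectral_norm B"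
    using x y by (simp add: norm_prod)
  moreover have "norm ?z = 1"
    using x y by (simp add: norm_prod)
  ultimately show "spectral_norm A * spectral_norm B \<le> spectral_norm (A \<otimes>\<^sub>K B)"
    using norm_le_spectral_norm[of "A \<otimes>\<^sub>K B" ?z] by simp
qed

section \<open>Matrix units and reflections\<close>

text \<open>This is f g^t without conjugation, hence additive and homogeneous in both
  arguments.\<close>

definition outer :: "complex^'m \<Rightarrow> complex^'n \<Rightarrow> complex^'n^'m"
  where "outer f g = (\<chi> i j. f $ i * g $ j)"

definition matrix_unit :: "'m \<Rightarrow> 'n \<Rightarrow> complex^'n^'m"
  where "matrix_unit i j = (\<chi> r s. if r = i \<and> s = j then 1 else 0)"

text \<open>Rank at most one is expressed by the vanishing of all 2 x 2 minors, so that minors at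
  well-chosen positions can be evaluated directly.\<close>

definition rank_le_1 :: "complex^'n^'m \<Rightarrow> bool"
  where "rank_le_1 M \<longleftrightarrow> (\<forall>p q r s. M $ p $ q * M $ r $ s = M $ p $ s * M $ r $ q)"

lemma matrix_unit_nth [simp]: "matrix_unit i j $ r $ s = (if r = i \<and> s = j then 1 else 0)"
  by (simp add: matrix_unit_def)

lemma matrix_unit_eq_outer: "matrix_unit i j = outer (axis i 1) (axis j 1)"
  by (simp add: vec_eq_iff outer_def axis_def)

lemma transpose_matrix_unit [simp]: "transpose (matrix_unit i j) = matrix_unit j i"
  by (simp add: vec_eq_iff transpose_def)

lemma mat_1_eq_sum_matrix_unit: "mat 1 = (\<Sum>i\<in>UNIV. matrix_unit i i)"
  by (simp add: vec_eq_iff mat_def if_distrib[of "\<lambda>x. x = _"] sum.If_cases)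

lemma sum_sum_delta:
  fixes g :: "'a::finite \<Rightarrow> 'b::finite \<Rightarrow> 'c::comm_monoid_add"
  shows "(\<Sum>i\<in>UNIV. \<Sum>k\<in>UNIV. if r = i \<and> s = k then g i k else 0) = g r s"
proof -
  have "(\<Sum>k\<in>UNIV. if r = i \<and> s = k then g i k else 0) = (if r = i then g i s else 0)" for i
    by simp
  then show ?thesis
    by simp
qed

lemma matrix_eq_sum_matrix_unit:
  "A = (\<Sum>i\<in>UNIV. \<Sum>k\<in>UNIV. cmat_scale (A $ i $ k) (matrix_unit i k))"
  by (simp add: vec_eq_iff cmat_scale_def if_distrib[of "(*) _"] sum_sum_delta cong: if_cong)

lemma matrix_unit_mult_vec: "matrix_unit i j *v x = axis i (x $ j)"
  by (simp add: vec_eq_iff matrix_vector_mult_def axis_def if_distrib[of "\<lambda>y. y * _"] if_conn cong: if_cong)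

lemma mult_matrix_unit_mult: "(U ** matrix_unit p q ** V) $ a $ b = U $ a $ p * V $ q $ b"
  by (simp add: matrix_matrix_mult_def if_distrib[of "(*) _"] if_distrib[of "\<lambda>y. y * _"] if_conn cong: if_cong)

lemma norm_axis [simp]: "norm (axis i c) = norm c"
  by (simp add: norm_vec_def L2_set_def axis_def if_distrib[of "\<lambda>y. (norm y)\<^sup>2"] cong: if_cong)

lemma spectral_norm_matrix_unit [simp]: "spectral_norm (matrix_unit i j) = 1"
proof (rule antisym)
  show "spectral_norm (matrix_unit i j) \<le> 1"
    by (rule spectral_norm_leI) (simp add: matrix_unit_mult_vec Finite_Cartesian_Product.norm_nth_le)
  show "1 \<le> spectral_norm (matrix_unit i j)"
    using norm_le_spectral_norm[of "matrix_unit i j" "axis j 1"]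
    by (simp add: matrix_unit_mult_vec norm_axis)
qed

lemma spectral_norm_mat_1 [simp]: "spectral_norm (mat 1 :: complex^'n^'n) = 1"
  by (metis spectral_norm_attained matrix_vector_mul_lid)

section \<open>Unitary matrices carrying an axis vector to a given vector\<close>

lemma cdot_diff_right: "cdot x (y - z) = cdot x y - cdot x z"
  by (simp add: cdot_def right_diff_distrib sum_subtractf)

lemma cdot_scale_right: "cdot x (c *s y) = c * cdot x y"
  by (simp add: cdot_def sum_distrib_left mult_ac)

lemma cdot_cnj: "cnj (cdot x y) = cdot y x"
  by (simp add: cdot_def mult.commute)

lemma cdot_axis_right: "cdot x (axis i c) = cnj (x $ i) * c"
  by (simp add: cdot_def axis_def if_distrib[of "(*) _"] cong: if_cong)

text \<open>A Householder reflection; for \<open>v = 0\<close> the convention \<open>2 / 0 = 0\<close> makes it the identity.\<close>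

lemma unitary_reflection:
  fixes v :: "complex^'n"
  obtains U where "unitary_matrix U"
    "\<And>x. U *v x = x - (complex_of_real (2 / (norm v)\<^sup>2) * cdot v x) *s v"
proof -
  define t where "t = complex_of_real (2 / (norm v)\<^sup>2)"
  define U where "U = (mat 1 - cmat_scale t (outer v (\<chi> i. cnj (v $ i))))"
  have eq: "U *v x = x - (t * cdot v x) *s v" for x
    by (simp add: U_def matrix_vector_mult_diff_rdistrib)
       (simp add: vec_eq_iff matrix_vector_mult_def cmat_scale_def outer_def cdot_def
         sum_distrib_left sum_distrib_right mult_ac)
  \<comment> \<open>\<open>U\<close> is both an involution and self-adjoint, hence unitary.\<close>
  have "U *v (U *v x) = x" for x
  proof (cases "v = 0")
    case False
    have "cdot v (U *v x) = cdot v x - t * cdot v x * cdot v v"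
      by (simp add: eq cdot_diff_right cdot_scale_right)
    also have "\<dots> = - cdot v x"
      using False by (simp add: t_def cdot_self)
    finally show ?thesis
      by (simp add: eq[of "U *v x"]) (simp add: eq)
  qed (simp add: eq)
  moreover have "conj_transpose U = U"
    by (auto simp: U_def t_def conj_transpose_def mat_def outer_def cmat_scale_def vec_eq_iff)
  ultimately have "unitary_matrix U"
    by (intro unitary_matrixI) (simp add: matrix_eq flip: matrix_vector_mul_assoc)
  with eq show thesis
    by (intro that) (simp_all add: t_def)
qed

text \<open>A reflection in the direction \<open>axis i c - f\<close> exchanges the two vectors as
  soon as they have equal norm and a real inner product.\<close>

lemma ex_unitary_axis:
  fixes f :: "complex^'n"
  obtains U c where "unitary_matrix U" "f = U *v axis i c"
proof -
  \<comment> \<open>The phase of \<open>f $ i\<close> makes \<open>cnj (f $ i) * c\<close> real.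
    When \<open>f $ i = 0\<close> any phase does; 1 is taken since \<open>sgn 0 = 0\<close> would
    lose the norm.\<close>
  define c where "c = complex_of_real (norm f) * (if f $ i = 0 then 1 else sgn (f $ i))"
  define v where "v = axis i c - f"
  obtain U where U: "unitary_matrix U"
    "\<And>x. U *v x = x - (complex_of_real (2 / (norm v)\<^sup>2) * cdot v x) *s v"
    using unitary_reflection[of v] by blast
  have norm_c: "cmod c = norm f"
    by (simp add: c_def norm_mult norm_sgn)
  define r where "r = norm f * cmod (f $ i)"
  have r: "cnj (f $ i) * c = complex_of_real r"
  proof -
    have "cnj z * sgn z = complex_of_real (cmod z)" for z
      by (simp add: sgn_eq complex_norm_square[symmetric] power2_eq_square mult.commute[of "cnj z"])
    then show ?thesis
      by (simp add: c_def r_def)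
  qed
  have "cnj c * c = complex_of_real ((norm f)\<^sup>2)"
    using complex_norm_square[of c] by (simp add: norm_c mult.commute)
  then have vw: "cdot v (axis i c) = complex_of_real ((norm f)\<^sup>2 - r)"
    by (simp add: v_def cdot_axis_right left_diff_distrib r)
  have vf: "cdot f v = complex_of_real (r - (norm f)\<^sup>2)"
    by (simp add: v_def cdot_diff_right cdot_axis_right r cdot_self)
  have "cdot v v = cdot v (axis i c) - cnj (cdot f v)"
    by (subst (2) v_def) (simp add: cdot_diff_right cdot_cnj)
  also have "\<dots> = complex_of_real (2 * ((norm f)\<^sup>2 - r))"
    by (simp add: vw vf del: of_real_diff of_real_mult flip: of_real_diff)
  finally have norm_v: "(norm v)\<^sup>2 = 2 * ((norm f)\<^sup>2 - r)"
    unfolding cdot_self of_real_eq_iff .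
  have "U *v axis i c = f"
  proof (cases "v = 0")
    case True
    then show ?thesis
      by (simp add: U(2)) (simp add: v_def)
  next
    case False
    \<comment> \<open>The coefficient of \<open>v\<close> in the reflection is exactly 1, so
      \<open>axis i c\<close> goes to \<open>axis i c - v = f\<close>.\<close>
    then have "complex_of_real (2 / (norm v)\<^sup>2) * cdot v (axis i c) = 1"
      unfolding vw norm_v of_real_mult[symmetric] using norm_v by auto
    then show ?thesis
      unfolding U(2) by (simp add: v_def)
  qed
  with U(1) that show thesis
    by metis
qed

section \<open>Products of diagonal matrix units\<close>

lemma matrix_mult_cmat_scale [simp]: "A ** cmat_scale c B = cmat_scale c (A ** B)"
  by (simp add: cmat_scale_def matrix_matrix_mult_def vec_eq_iff sum_distrib_left mult_ac)

lemma cmat_scale_matrix_mult [simp]: "cmat_scale c A ** B = cmat_scale c (A ** B)"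
  by (simp add: cmat_scale_def matrix_matrix_mult_def vec_eq_iff sum_distrib_left mult_ac)

lemma matrix_mult_add_rdistrib: "(A + B) ** C = A ** C + B ** (C :: 'a::semiring_1^'k^'n)"
  by (simp add: matrix_matrix_mult_def vec_eq_iff distrib_right sum.distrib)

lemma norm_smult: "norm (c *s x) = cmod c * norm x"
  by (simp add: norm_vec_def norm_mult L2_set_right_distrib)

lemma cmat_scale_transpose [simp]: "transpose (cmat_scale c A) = cmat_scale c (transpose A)"
  by (simp add: cmat_scale_def transpose_def vec_eq_iff)

lemma transpose_add [simp]: "transpose (A + B) = transpose A + transpose (B :: 'a::plus^'m^'n)"
  by (simp add: transpose_def vec_eq_iff)

text \<open>By the parallelogram law the mean of the two squared norms is 1 + |v|^2.\<close>

lemma norm_plus_minus_le_1_imp_0: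
  fixes u v :: "'a::real_inner"
  assumes "norm u = 1" "norm (u + v) \<le> 1" "norm (u - v) \<le> 1"
  shows "v = 0"
proof -
  have "(norm (u + v))\<^sup>2 \<le> 1" "(norm (u - v))\<^sup>2 \<le> 1"
    using assms by (simp_all add: power_le_one)
  then have "(norm v)\<^sup>2 \<le> 0"
    using assms(1) by (simp add: power2_norm_eq_inner inner_add inner_diff inner_commute norm_eq_1)
  then show ?thesis
    by simp
qed

lemma spectral_norm_two_units:
  assumes "i \<noteq> k"
  shows "spectral_norm (matrix_unit i i + matrix_unit k k) \<le> 1"
    "spectral_norm (matrix_unit i i - matrix_unit k k) \<le> 1"
proof -
  \<comment> \<open>Only the moduli of \<open>a\<close> and \<open>b\<close> are prescribed, so both
    signs are covered at once.\<close>
  have le: "norm (axis i a + axis k b) \<le> norm x" if "cmod a = cmod (x $ i)" "cmod b = cmod (x $ k)"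
    for a b and x :: "complex^'a"
  proof -
    have "(cmod ((axis i a + axis k b) $ r))\<^sup>2 \<le> (cmod (x $ r))\<^sup>2" for r
      using assms that by (cases "r = i"; cases "r = k") (simp_all add: axis_def)
    then have "(norm (axis i a + axis k b))\<^sup>2 \<le> (norm x)\<^sup>2"
      unfolding norm_vec_power2 by (rule sum_mono)
    then show ?thesis
      by (rule power2_le_imp_le) simp
  qed
  have diff: "axis i a - axis k b = axis i a + axis k (- b)" for a b :: complex
    by (simp add: vec_eq_iff axis_def)
  show "spectral_norm (matrix_unit i i + matrix_unit k k) \<le> 1"
    "spectral_norm (matrix_unit i i - matrix_unit k k) \<le> 1"
    by (intro spectral_norm_leI;
        simp add: matrix_vector_mult_add_rdistrib matrix_vector_mult_diff_rdistrib matrix_unit_mult_vec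
          diff le)+
qed

text \<open>\<open>F A B\<close> stands for the image of the Kronecker product. The bilinear
  formulation is stable under unitary changes of bases and under transposing one argument; the norm
  condition is the one on Kronecker products, rewritten by
  \<open>spectral_norm_kron\<close>.\<close>

locale kron_isometry =
  fixes F :: "complex^'m^'m \<Rightarrow> complex^'n^'n \<Rightarrow> complex^('m \<times> 'n)^('m \<times> 'n)"
  assumes add_left: "F (A + A') B = F A B + F A' B"
    and add_right: "F A (B + B') = F A B + F A B'"
    and scale_left: "F (cmat_scale c A) B = cmat_scale c (F A B)"
    and scale_right: "F A (cmat_scale c B) = cmat_scale c (F A B)"
    and spectral_norm: "spectral_norm (F A B) = spectral_norm A * spectral_norm B"
begin

lemma zero_left [simp]: "F 0 B = 0"
  using add_left[of 0 0 B] by simp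

lemma zero_right [simp]: "F A 0 = 0"
  using add_right[of A 0 0] by simp

lemma diff_left: "F (A - A') B = F A B - F A' B"
  using add_left[of "A - A'" A' B] by simp

lemma diff_right: "F A (B - B') = F A B - F A B'"
  using add_right[of A "B - B'" B'] by simp

lemma sum_left: "F (sum f S) B = (\<Sum>i\<in>S. F (f i) B)"
  by (induction S rule: infinite_finite_induct) (simp_all add: add_left)

lemma sum_right: "F A (sum f S) = (\<Sum>i\<in>S. F A (f i))"
  by (induction S rule: infinite_finite_induct) (simp_all add: add_right)

lemma kron_isometry_unitary:
  assumes "unitary_matrix U" "unitary_matrix V" "unitary_matrix U\<^sub>1" "unitary_matrix V\<^sub>1"
    "unitary_matrix U\<^sub>2" "unitary_matrix V\<^sub>2"
  shows "kron_isometry (\<lambda>A B. U ** F (U\<^sub>1 ** A ** V\<^sub>1) (U\<^sub>2 ** B ** V\<^sub>2) ** V)"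
  by unfold_locales
    (simp_all add: matrix_add_ldistrib matrix_mult_add_rdistrib add_left add_right scale_left scale_right
      spectral_norm spectral_norm_unitary assms)

lemma kron_isometry_transpose_left: "kron_isometry (\<lambda>A. F (transpose A))"
  by unfold_locales
    (simp_all add: add_left add_right scale_left scale_right spectral_norm spectral_norm_transpose)

lemma kron_isometry_transpose_right: "kron_isometry (\<lambda>A B. F A (transpose B))"
  by unfold_locales
    (simp_all add: add_left add_right scale_left scale_right spectral_norm spectral_norm_transpose)

lemma norming_vector_orthogonal:
  assumes x: "norm x = 1" "norm (F (matrix_unit i i) (matrix_unit j j) *v x) = 1"
    and neq: "(k, l) \<noteq> (i, j)"
  shows "F (matrix_unit k k) (matrix_unit l l) *v x = 0"
proof -
  let ?G = "\<lambda>i j. F (matrix_unit i i) (matrix_unit j j) *v x"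
  have le: "norm (F A B *v x) \<le> 1" if "spectral_norm A \<le> 1" "spectral_norm B \<le> 1" for A B
    using norm_le_spectral_norm[of "F A B" x] that x(1)
      mult_mono[of "spectral_norm A" 1 "spectral_norm B" 1]
    by (simp add: spectral_norm spectral_norm_nonneg)
  have left: "?G k j = 0" if "k \<noteq> i" for k
    using le[of "matrix_unit i i + matrix_unit k k" "matrix_unit j j"]
      le[of "matrix_unit i i - matrix_unit k k" "matrix_unit j j"] that x(2)
    by (intro norm_plus_minus_le_1_imp_0[of "?G i j"])
      (simp_all add: spectral_norm_two_units add_left diff_left
        matrix_vector_mult_add_rdistrib matrix_vector_mult_diff_rdistrib)
  have right: "?G i l = 0" if "l \<noteq> j" for l
    using le[of "matrix_unit i i" "matrix_unit j j + matrix_unit l l"]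
      le[of "matrix_unit i i" "matrix_unit j j - matrix_unit l l"] that x(2)
    by (intro norm_plus_minus_le_1_imp_0[of "?G i j"])
      (simp_all add: spectral_norm_two_units add_right diff_right
        matrix_vector_mult_add_rdistrib matrix_vector_mult_diff_rdistrib)
  \<comment> \<open>The mixed terms \<open>?G k j\<close> and \<open>?G i l\<close> already vanish,
    so the two four-term sums reduce to \<open>?G i j + ?G k l\<close> and
    \<open>?G i j - ?G k l\<close>.\<close>
  have "?G k l = 0" if "k \<noteq> i" "l \<noteq> j"
    using le[of "matrix_unit i i + matrix_unit k k" "matrix_unit j j + matrix_unit l l"]
      le[of "matrix_unit i i + matrix_unit k k" "matrix_unit j j - matrix_unit l l"] that x(2)
    by (intro norm_plus_minus_le_1_imp_0[of "?G i j"])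
      (simp_all add: spectral_norm_two_units add_left diff_left add_right diff_right left right
        matrix_vector_mult_add_rdistrib matrix_vector_mult_diff_rdistrib)
  with left right neq show ?thesis
    by auto
qed

text \<open>The norming vectors form a basis; the norm bound identifies it with its dual basis,
  which makes it orthonormal. The image of the identity then yields orthonormality of the vectors
  \<open>y p\<close>.\<close>

lemma ex_unitary_diagonal_form:
  "\<exists>Y X. unitary_matrix Y \<and> unitary_matrix X \<and>
    (\<forall>i j. F (matrix_unit i i) (matrix_unit j j) = Y ** matrix_unit (i, j) (i, j) ** X)"
proof -
  define G where "G p = F (matrix_unit (fst p) (fst p)) (matrix_unit (snd p) (snd p))" for p
  have "\<exists>x. norm x = 1 \<and> norm (G p *v x) = 1" for p
    using spectral_norm_attained[of "G p"] by (auto simp: G_def spectral_norm)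
  then obtain x where x: "\<And>p. norm (x p) = 1" "\<And>p. norm (G p *v x p) = 1"
    by metis
  have Gx: "G q *v x p = 0" if "q \<noteq> p" for p q
    using norming_vector_orthogonal[of "x p" "fst p" "snd p" "fst q" "snd q"] x that
    by (simp add: G_def prod_eq_iff)
  define y where "y p = G p *v x p" for p
  have norm_y: "norm (y p) = 1" for p
    by (simp add: x y_def)
  define X where "X = (\<chi> a p. x p $ a)"
  have GX: "(G q ** X) $ a $ p = (if p = q then y q $ a else 0)" for q a p
  proof -
    have "(G q ** X) $ a $ p = (G q *v x p) $ a"
      by (simp add: matrix_matrix_mult_def matrix_vector_mult_def X_def)
    then show ?thesis
      by (simp add: y_def Gx)
  qed
  \<comment> \<open>Linear independence of the columns \<open>x p\<close>: applying
    \<open>G q\<close> to the combination keeps only the term \<open>c $ q *s y q\<close>, and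
    \<open>y q\<close> is a unit vector.\<close>
  have "c = 0" if "X *v c = 0" for c
  proof -
    have "c $ q = 0" for q
    proof -
      have "0 = (G q ** X) *v c"
        using that by (simp flip: matrix_vector_mul_assoc)
      also have "\<dots> = c $ q *s y q"
        by (simp add: vec_eq_iff matrix_vector_mult_def[of "G q ** X"] GX mult.commute
            if_distrib[of "(*) _"] cong: if_cong)
      finally show ?thesis
        using norm_y[of q] by auto
    qed
    then show ?thesis
      by (simp add: vec_eq_iff)
  qed
  then obtain W where WX: "W ** X = mat 1"
    by (metis matrix_left_invertible_ker)
  then have XW: "X ** W = mat 1"
    by (metis matrix_left_right_inverse)
  \<comment> \<open>The vectors \<open>w q\<close> are the basis dual to the \<open>x p\<close> with
    respect to \<open>cdot\<close>, and \<open>G q\<close> turns out to be \<open>y q\<close> times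
    the adjoint of \<open>w q\<close>.\<close>
  define w where "w q = (\<chi> a. cnj (W $ q $ a))" for q
  have GW: "G q $ a $ b = y q $ a * W $ q $ b" for q a b
  proof -
    have "G q = (G q ** X) ** W"
      using XW by (simp flip: matrix_mul_assoc)
    moreover have "((G q ** X) ** W) $ a $ b = (\<Sum>p\<in>UNIV. (G q ** X) $ a $ p * W $ p $ b)"
      by (simp add: matrix_matrix_mult_def[of "G q ** X"])
    ultimately have "G q $ a $ b = (\<Sum>p\<in>UNIV. (G q ** X) $ a $ p * W $ p $ b)"
      by simp
    then show ?thesis
      by (simp add: GX if_distrib[of "\<lambda>z. z * _"] cong: if_cong)
  qed
  have Gw: "G q *v v = cdot (w q) v *s y q" for q v
    by (simp add: vec_eq_iff matrix_vector_mult_def GW cdot_def w_def sum_distrib_left mult_ac)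
  \<comment> \<open>Testing \<open>G q\<close> on \<open>w q\<close> gives |w q| <= 1. Since the
    inner product of \<open>w q\<close> with the unit vector \<open>x q\<close> is 1, the two
    coincide.\<close>
  have wx: "w q = x q" for q
  proof -
    have "norm (w q) * norm (w q) = norm (G q *v w q)"
      by (simp add: Gw cdot_self norm_smult norm_y power2_eq_square norm_mult)
    also have "\<dots> \<le> norm (w q)"
      using norm_le_spectral_norm[of "G q" "w q"] by (simp add: G_def spectral_norm)
    finally have "norm (w q) \<le> 1"
      by (cases "w q = 0") auto
    then have "(norm (w q))\<^sup>2 \<le> 1"
      by (simp add: power_le_one)
    have "(W ** X) $ q $ q = 1"
      by (simp add: WX mat_def)
    then have "cdot (w q) (x q) = 1"
      by (simp add: matrix_matrix_mult_def cdot_def w_def X_def)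
    then have "w q \<bullet> x q = 1"
      by (simp add: inner_eq_Re_cdot)
    then have "(norm (w q - x q))\<^sup>2 \<le> 0"
      using \<open>(norm (w q))\<^sup>2 \<le> 1\<close> x(1)[of q]
      by (simp add: power2_norm_eq_inner inner_diff inner_commute norm_eq_1)
    then show ?thesis
      by simp
  qed
  have "W $ q $ a = cnj (x q $ a)" for q a
    by (simp add: w_def flip: wx)
  then have "W = conj_transpose X"
    by (simp add: vec_eq_iff conj_transpose_def X_def)
  with WX XW have unitary_W: "unitary_matrix W"
    by (simp add: unitary_matrix_def)
  define Y where "Y = (\<chi> a p. y p $ a)"
  have GY: "G q = Y ** matrix_unit q q ** W" for q
    by (simp add: vec_eq_iff mult_matrix_unit_mult GW Y_def)
  \<comment> \<open>Summing over all \<open>q\<close> bounds \<open>Y\<close> as a whole: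
    \<open>Y ** W\<close> is the image of a pair of identity matrices, so \<open>Y\<close> and its
    adjoint have norm 1.\<close>
  have "F (mat 1) (mat 1) = (\<Sum>q\<in>UNIV. G q)"
    by (simp add: mat_1_eq_sum_matrix_unit sum_left sum_right G_def sum_prod_UNIV) (rule sum.swap)
  also have "\<dots> = Y ** W"
    by (simp add: vec_eq_iff GW matrix_matrix_mult_def Y_def)
  finally have "spectral_norm (Y ** W) = 1"
    by (metis spectral_norm spectral_norm_mat_1 mult_1)
  then have norm_Y: "spectral_norm (conj_transpose Y) = 1"
    by (simp add: spectral_norm_conj_transpose spectral_norm_mult_unitary[OF unitary_W])
  \<comment> \<open>The adjoint of \<open>Y\<close> maps the unit vector \<open>y q\<close> to a
    vector of norm at most 1 whose coordinate at \<open>q\<close> is already 1, so the other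
    coordinates vanish.\<close>
  have "cdot (y p) (y q) = (if p = q then 1 else 0)" for p q
  proof -
    have nth: "(conj_transpose Y *v y q) $ p = cdot (y p) (y q)" for p
      by (simp add: conj_transpose_def matrix_vector_mult_def cdot_def Y_def)
    have self: "cdot (y q) (y q) = 1" for q
      by (simp add: cdot_self norm_y)
    have "(norm (conj_transpose Y *v y q))\<^sup>2 \<le> 1"
      using norm_le_spectral_norm[of "conj_transpose Y" "y q"]
      by (simp add: norm_Y norm_y power_le_one)
    also have "(norm (conj_transpose Y *v y q))\<^sup>2 = (\<Sum>p\<in>UNIV. (cmod (cdot (y p) (y q)))\<^sup>2)"
      by (simp add: norm_vec_power2 nth)
    also have "\<dots> = 1 + (\<Sum>p\<in>UNIV - {q}. (cmod (cdot (y p) (y q)))\<^sup>2)"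
      by (subst sum.remove[of _ q]) (simp_all add: self)
    finally have "(\<Sum>p\<in>UNIV - {q}. (cmod (cdot (y p) (y q)))\<^sup>2) = 0"
      by (simp add: antisym sum_nonneg)
    then show ?thesis
      by (auto simp: self sum_nonneg_eq_0_iff)
  qed
  then have "conj_transpose Y ** Y = mat 1"
    by (simp add: vec_eq_iff mat_def conj_transpose_def matrix_matrix_mult_def Y_def cdot_def)
  then have "unitary_matrix Y"
    by (rule unitary_matrixI)
  moreover have "F (matrix_unit i i) (matrix_unit j j) = Y ** matrix_unit (i, j) (i, j) ** W" for i j
    using GY[of "(i, j)"] by (simp add: G_def)
  ultimately show ?thesis
    using unitary_W by blast
qed

end

section \<open>Matrices of rank at most one\<close>

lemma rank_le_1_cmat_scale: "rank_le_1 M \<Longrightarrow> rank_le_1 (cmat_scale c M)"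
proof -
  assume M: "rank_le_1 M"
  have "c * M $ p $ q * (c * M $ r $ s) = c * c * (M $ p $ q * M $ r $ s)" for p q r s
    by (simp only: mult_ac)
  then show ?thesis
    using M by (simp only: rank_le_1_def cmat_scale_def vec_lambda_beta) metis
qed

lemma mult_outer_mult: "U ** outer f g ** V = outer (U *v f) (transpose V *v g)"
  by (simp add: outer_def matrix_matrix_mult_def matrix_vector_mult_def vec_eq_iff transpose_def
      sum_product sum_distrib_left sum_distrib_right mult_ac) (intro allI, rule sum.swap)

definition supported_at :: "complex^'n^'m \<Rightarrow> 'm \<Rightarrow> 'n \<Rightarrow> bool"
  where "supported_at M p q \<longleftrightarrow> (\<forall>r s. M $ r $ s \<noteq> 0 \<longrightarrow> r = p \<and> s = q)"

lemma supported_at_matrix_unit [simp]: "supported_at (matrix_unit p q) p q"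
  by (simp add: supported_at_def)

text \<open>If (r, s) avoided row \<open>p\<close> and column \<open>q\<close>, the minor of
  \<open>M + N\<close> on rows p, r and columns q, s would exceed that of \<open>N\<close> by the
  nonzero product of \<open>M $ p $ q\<close> and \<open>N $ r $ s\<close>.\<close>

lemma rank_le_1_add_supported_at:
  assumes "rank_le_1 M" "rank_le_1 N" "rank_le_1 (M + N)"
    and "supported_at M p q" and "M \<noteq> 0" and "N $ r $ s \<noteq> 0"
  shows "r = p \<or> s = q"
proof (rule ccontr)
  assume neq: "\<not> (r = p \<or> s = q)"
  have "M $ p $ q * M $ r $ s = M $ p $ s * M $ r $ q"
    "N $ p $ q * N $ r $ s = N $ p $ s * N $ r $ q"
    "(M + N) $ p $ q * (M + N) $ r $ s = (M + N) $ p $ s * (M + N) $ r $ q"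
    using assms(1-3) unfolding rank_le_1_def by blast+
  moreover have "M $ r $ s = 0" "M $ p $ s = 0" "M $ r $ q = 0"
    using assms(4) neq unfolding supported_at_def by blast+
  ultimately have "M $ p $ q * N $ r $ s = 0"
    by (simp add: algebra_simps)
  moreover have "M $ p $ q \<noteq> 0"
    using assms(4,5) unfolding supported_at_def by (metis vec_eq_iff zero_index)
  ultimately show False
    using assms(6) by simp
qed

text \<open>This treats a single factor: \<open>G i k\<close> is the image of a matrix unit and
  \<open>e\<close> lists the positions of the diagonal ones. Each off-diagonal image has two
  possible positions, and the rank conditions on sums force the same choice throughout.\<close>

lemma matrix_unit_images_dichotomy:
  fixes G :: "'a::finite \<Rightarrow> 'a \<Rightarrow> complex^'p^'p" and e :: "'a \<Rightarrow> 'p"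
  assumes "inj e" and diag: "\<And>i. G i i = matrix_unit (e i) (e i)" and nz: "\<And>i k. G i k \<noteq> 0"
    and rank: "\<And>i k. rank_le_1 (G i k)"
    and row: "\<And>i k l. k \<noteq> l \<Longrightarrow> rank_le_1 (G i k + G i l)"
    and col: "\<And>i k l. i \<noteq> l \<Longrightarrow> rank_le_1 (G i k + G l k)"
    and block: "\<And>i k. i \<noteq> k \<Longrightarrow> rank_le_1 (G i i + G i k + (G k i + G k k))"
  shows "(\<forall>i k. supported_at (G i k) (e i) (e k)) \<or> (\<forall>i k. supported_at (G i k) (e k) (e i))"
proof -
  have e: "e i = e k \<longleftrightarrow> i = k" for i k
    using \<open>inj e\<close> by (simp add: inj_eq)
  define \<sigma> where "\<sigma> i k \<longleftrightarrow> supported_at (G i k) (e i) (e k)" for i k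
  have cases: "\<sigma> i k \<or> supported_at (G i k) (e k) (e i)" if "i \<noteq> k" for i k
  proof -
    \<comment> \<open>Comparison with \<open>G i i\<close> (same row) and with \<open>G k k\<close>
      (same column) leaves only the positions (e i, e k) and (e k, e i); the rank of
      \<open>G i k\<close> itself excludes both being occupied.\<close>
    have *: "(r = e i \<or> s = e i) \<and> (r = e k \<or> s = e k)" if "G i k $ r $ s \<noteq> 0" for r s
    proof
      show "r = e i \<or> s = e i"
        using row[of i k i] \<open>i \<noteq> k\<close> that
        by (intro rank_le_1_add_supported_at[of "G i i" "G i k"])
          (simp_all add: rank nz add.commute, simp add: diag)
      show "r = e k \<or> s = e k"
        using col[of k i k] \<open>i \<noteq> k\<close> that
        by (intro rank_le_1_add_supported_at[of "G k k" "G i k"])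
          (simp_all add: rank nz add.commute, simp add: diag)
    qed
    have "G i k $ e i $ e i * G i k $ e k $ e k = G i k $ e i $ e k * G i k $ e k $ e i"
      using rank unfolding rank_le_1_def by blast
    moreover have "G i k $ e i $ e i = 0"
      using *[of "e i" "e i"] \<open>i \<noteq> k\<close> by (auto simp: e)
    ultimately have "G i k $ e i $ e k = 0 \<or> G i k $ e k $ e i = 0"
      by auto
    moreover have "r = e i \<and> s = e k \<or> r = e k \<and> s = e i" if "G i k $ r $ s \<noteq> 0" for r s
      using *[OF that] e \<open>i \<noteq> k\<close> by auto
    ultimately show ?thesis
      unfolding \<sigma>_def supported_at_def by blast
  qed
  have pos: "G i k $ e i $ e k \<noteq> 0" if "\<sigma> i k" for i k
    using that nz[of i k] unfolding \<sigma>_def supported_at_def by (metis vec_eq_iff zero_index)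
  have neg: "G i k $ e k $ e i \<noteq> 0" if "\<not> \<sigma> i k" "i \<noteq> k" for i k
    using that cases[of i k] nz[of i k] unfolding supported_at_def by (metis vec_eq_iff zero_index)
  have off: "G i k $ r $ s = 0" if "\<sigma> i k" "r \<noteq> e i \<or> s \<noteq> e k" for i k r s
    using that unfolding \<sigma>_def supported_at_def by blast
  have off': "G i k $ r $ s = 0" if "\<not> \<sigma> i k" "i \<noteq> k" "r \<noteq> e k \<or> s \<noteq> e i" for i k r s
    using that cases[of i k] unfolding supported_at_def by blast
  \<comment> \<open>Otherwise \<open>G i k\<close> and \<open>G k i\<close> both sit at (e i, e k),
    and the two diagonal ones give the block a minor equal to 1.\<close>
  have sym: "\<sigma> k i" if "\<sigma> i k" "i \<noteq> k" for i k
  proof (rule ccontr)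
    assume "\<not> \<sigma> k i"
    then have "G i k $ e k $ e i = 0" "G k i $ e k $ e i = 0" "G i k $ e i $ e i = 0"
      "G k i $ e i $ e i = 0" "G i k $ e k $ e k = 0" "G k i $ e k $ e k = 0"
      using that off[of i k] off'[of k i] e by auto
    moreover have "(G i i + G i k + (G k i + G k k)) $ e i $ e i * (G i i + G i k + (G k i + G k k)) $ e k $ e k
      = (G i i + G i k + (G k i + G k k)) $ e i $ e k * (G i i + G i k + (G k i + G k k)) $ e k $ e i"
      using block[OF that(2)] unfolding rank_le_1_def by blast
    ultimately show False
      using that(2) by (simp add: diag e)
  qed
  \<comment> \<open>Otherwise \<open>G i k + G i l\<close> has nonzero entries at (e i, e k) and (e
    l, e i) and zeros at the two remaining corners.\<close>
  have trans: "\<sigma> i l" if "\<sigma> i k" "i \<noteq> k" "i \<noteq> l" for i k l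
  proof (rule ccontr)
    assume \<sigma>: "\<not> \<sigma> i l"
    with that have "k \<noteq> l"
      by auto
    have "(G i k + G i l) $ e i $ e k * (G i k + G i l) $ e l $ e i =
        (G i k + G i l) $ e i $ e i * (G i k + G i l) $ e l $ e k"
      using row[OF \<open>k \<noteq> l\<close>] unfolding rank_le_1_def by blast
    then have "G i k $ e i $ e k * G i l $ e l $ e i = 0"
      using that \<sigma> off[of i k] off'[of i l] e by simp
    then show False
      using pos[of i k] neg[of i l] that \<sigma> by simp
  qed
  have const: "\<sigma> i' k'" if "\<sigma> i k" "i \<noteq> k" "i' \<noteq> k'" for i k i' k'
    using that sym trans by metis
  have "\<sigma> i i" for i
    by (simp add: \<sigma>_def diag)
  show ?thesis
  proof (cases "\<exists>i k. i \<noteq> k \<and> \<sigma> i k")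
    case True
    then have "\<sigma> i k" for i k
      using const \<open>\<And>i. \<sigma> i i\<close> by metis
    then show ?thesis
      by (simp add: \<sigma>_def)
  next
    case False
    then have "supported_at (G i k) (e k) (e i)" for i k
      using cases[of i k] by (cases "i = k") (auto simp: diag)
    then show ?thesis
      by blast
  qed
qed

context kron_isometry
begin

text \<open>Unitary changes of bases turn both outer products into multiples of one diagonal matrix
  unit, here at the arbitrary index \<open>undefined\<close>. The diagonal form of the transformed
  isometry then applies.\<close>

lemma rank_le_1_outer_outer: "rank_le_1 (F (outer f g) (outer h k))"
proof -
  obtain U\<^sub>1 a where 1: "unitary_matrix U\<^sub>1" "f = U\<^sub>1 *v axis undefined a"
    by (rule ex_unitary_axis)
  obtain V\<^sub>1 b where 2: "unitary_matrix V\<^sub>1" "g = V\<^sub>1 *v axis undefined b"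
    by (rule ex_unitary_axis)
  obtain U\<^sub>2 c where 3: "unitary_matrix U\<^sub>2" "h = U\<^sub>2 *v axis undefined c"
    by (rule ex_unitary_axis)
  obtain V\<^sub>2 d where 4: "unitary_matrix V\<^sub>2" "k = V\<^sub>2 *v axis undefined d"
    by (rule ex_unitary_axis)
  have outer: "outer (U *v axis i x) (V *v axis j y) =
      cmat_scale (x * y) (U ** matrix_unit i j ** transpose V)"
    for U :: "complex^'a^'a" and V :: "complex^'b^'b" and i j x y
  proof -
    have *: "outer (axis i x) (axis j y) = cmat_scale (x * y) (matrix_unit i j)"
      by (auto simp: vec_eq_iff outer_def axis_def cmat_scale_def)
    have "cmat_scale (x * y) (U ** matrix_unit i j ** transpose V) =
        U ** outer (axis i x) (axis j y) ** transpose V"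
      by (simp add: *)
    then show ?thesis
      by (simp add: mult_outer_mult)
  qed
  interpret F': kron_isometry
    "\<lambda>A B. mat 1 ** F (U\<^sub>1 ** A ** transpose V\<^sub>1) (U\<^sub>2 ** B ** transpose V\<^sub>2) ** mat 1"
    using 1 2 3 4 by (intro kron_isometry_unitary unitary_matrix_mat_1 unitary_matrix_transpose)
  obtain Y X :: "complex^('m \<times> 'n)^('m \<times> 'n)" where YX: "F (U\<^sub>1 ** matrix_unit undefined undefined ** transpose V\<^sub>1)
      (U\<^sub>2 ** matrix_unit undefined undefined ** transpose V\<^sub>2) =
    Y ** matrix_unit (undefined, undefined) (undefined, undefined) ** X"
    using F'.ex_unitary_diagonal_form unfolding matrix_mul_lid matrix_mul_rid by blast
  show ?thesis
    unfolding 1(2) 2(2) 3(2) 4(2) outer scale_left scale_right YX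
    by (intro rank_le_1_cmat_scale) (simp add: rank_le_1_def mult_matrix_unit_mult mult_ac)
qed

end

section \<open>Positions of the images of matrix units\<close>

lemma spectral_norm_cmat_scale:
  fixes A :: "complex^'n^'m"
  shows "spectral_norm (cmat_scale c A) = cmod c * spectral_norm A"
proof -
  have eq: "cmat_scale c A *v x = c *s (A *v x)" for x
    by (simp add: vec_eq_iff cmat_scale_def matrix_vector_mult_def sum_distrib_left mult_ac)
  obtain x where "norm x = 1" "norm (A *v x) = spectral_norm A"
    by (rule spectral_norm_attained)
  then have "cmod c * spectral_norm A \<le> spectral_norm (cmat_scale c A)"
    using norm_le_spectral_norm[of "cmat_scale c A" x] by (simp add: eq norm_smult)
  moreover have "spectral_norm (cmat_scale c A) \<le> cmod c * spectral_norm A"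
    by (rule spectral_norm_leI)
      (simp add: eq norm_smult norm_le_spectral_norm mult_left_mono mult.assoc)
  ultimately show ?thesis
    by simp
qed

definition diagonal_matrix :: "('n \<Rightarrow> complex) \<Rightarrow> complex^'n^'n"
  where "diagonal_matrix d = (\<chi> p q. if p = q then d p else 0)"

lemma unitary_diagonal_matrix:
  assumes "\<And>p. cmod (d p) = 1"
  shows "unitary_matrix (diagonal_matrix d)"
proof (rule unitary_matrixI)
  have "cnj (d p) * d p = 1" for p
    using complex_norm_square[of "d p"] assms by (simp add: mult.commute)
  then show "conj_transpose (diagonal_matrix d) ** diagonal_matrix d = mat 1"
    by (simp add: vec_eq_iff conj_transpose_def diagonal_matrix_def matrix_matrix_mult_def mat_def
        if_distrib[of "\<lambda>z. z * _"] if_distrib[of cnj] cong: if_cong)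
qed

lemma diagonal_matrix_mult_mult:
  "(diagonal_matrix c ** M ** diagonal_matrix d) $ p $ q = c p * M $ p $ q * d q"
  by (simp add: diagonal_matrix_def matrix_matrix_mult_def if_distrib[of "\<lambda>z. z * _"]
      if_distrib[of "(*) _"] cong: if_cong)

lemma outer_add_left: "outer (f + g) h = outer f h + outer g h"
  by (simp add: outer_def vec_eq_iff distrib_right)

lemma outer_add_right: "outer f (g + h) = outer f g + outer f h"
  by (simp add: outer_def vec_eq_iff distrib_left)

context kron_isometry
begin

abbreviation unit_image :: "'m \<Rightarrow> 'm \<Rightarrow> 'n \<Rightarrow> 'n \<Rightarrow> complex^('m \<times> 'n)^('m \<times> 'n)"
  where "unit_image i k j l \<equiv> F (matrix_unit i k) (matrix_unit j l)"

lemma unit_image_nonzero: "unit_image i k j l \<noteq> 0"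
  using spectral_norm[of "matrix_unit i k" "matrix_unit j l"] by auto

lemma rank_le_1_unit_image: "rank_le_1 (unit_image i k j l)"
  by (simp add: matrix_unit_eq_outer rank_le_1_outer_outer)

lemma rank_le_1_unit_image_add:
  "rank_le_1 (unit_image i k j l + unit_image i k' j l)"
  "rank_le_1 (unit_image i k j l + unit_image i' k j l)"
  "rank_le_1 (unit_image i k j l + unit_image i k j l')"
  "rank_le_1 (unit_image i k j l + unit_image i k j' l)"
  unfolding matrix_unit_eq_outer add_left[symmetric] add_right[symmetric]
    outer_add_left[symmetric] outer_add_right[symmetric]
  by (rule rank_le_1_outer_outer)+

text \<open>The four matrix units add up to the outer product of a sum of two axis vectors with
  itself.\<close>

lemma rank_le_1_unit_image_block:
  "rank_le_1 (unit_image i i j l + unit_image i k j l + (unit_image k i j l + unit_image k k j l))"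
  "rank_le_1 (unit_image i k j j + unit_image i k j l + (unit_image i k l j + unit_image i k l l))"
  unfolding matrix_unit_eq_outer add_left[symmetric] add_right[symmetric]
    outer_add_left[symmetric] outer_add_right[symmetric]
  by (rule rank_le_1_outer_outer)+

lemma unit_image_nonzero_entry:
  obtains r s where "unit_image i k j l $ r $ s \<noteq> 0"
  using unit_image_nonzero[of i k j l] by (auto simp: vec_eq_iff)

end

section \<open>Orientation of the images in each factor\<close>

locale diagonal_kron_isometry = kron_isometry F
  for F :: "complex^'m^'m \<Rightarrow> complex^'n^'n \<Rightarrow> complex^('m \<times> 'n)^('m \<times> 'n)" +
  assumes diagonal: "F (matrix_unit i i) (matrix_unit j j) = matrix_unit (i, j) (i, j)"
begin

text \<open>The orientation in the first factor is tested against one diagonal unit of the second,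
  so a priori it depends on \<open>j\<close>.\<close>

definition upright_left :: "'n \<Rightarrow> bool"
  where "upright_left j \<longleftrightarrow> (\<forall>i k. supported_at (unit_image i k j j) (i, j) (k, j))"

definition flipped_left :: "'n \<Rightarrow> bool"
  where "flipped_left j \<longleftrightarrow> (\<forall>i k. supported_at (unit_image i k j j) (k, j) (i, j))"

definition upright_right :: "'m \<Rightarrow> bool"
  where "upright_right i \<longleftrightarrow> (\<forall>j l. supported_at (unit_image i i j l) (i, j) (i, l))"

definition flipped_right :: "'m \<Rightarrow> bool"
  where "flipped_right i \<longleftrightarrow> (\<forall>j l. supported_at (unit_image i i j l) (i, l) (i, j))"

lemma left_cases: "upright_left j \<or> flipped_left j"
  unfolding upright_left_def flipped_left_def
  by (rule matrix_unit_images_dichotomy[where G = "\<lambda>i k. unit_image i k j j" and e = "\<lambda>i. (i, j)"])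
    (simp_all add: diagonal inj_def rank_le_1_unit_image rank_le_1_unit_image_add
      rank_le_1_unit_image_block unit_image_nonzero flip: diagonal)

lemma right_cases: "upright_right i \<or> flipped_right i"
  unfolding upright_right_def flipped_right_def
  by (rule matrix_unit_images_dichotomy[where G = "\<lambda>j l. unit_image i i j l" and e = "\<lambda>j. (i, j)"])
    (simp_all add: diagonal inj_def rank_le_1_unit_image rank_le_1_unit_image_add
      rank_le_1_unit_image_block unit_image_nonzero flip: diagonal)

text \<open>Replacing one index makes one of the two units diagonal. The image of that neighbour has
  a known position and its sum with the given image has rank at most one, so every nonzero entry
  shares its row or column.\<close>

lemma unit_image_entry_cases:
  assumes "unit_image i k j l $ r $ s \<noteq> 0"
  shows "upright_left j \<Longrightarrow> r = (i, j) \<or> s = (k, j)"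
    "flipped_left j \<Longrightarrow> r = (k, j) \<or> s = (i, j)"
    "upright_left l \<Longrightarrow> r = (i, l) \<or> s = (k, l)"
    "flipped_left l \<Longrightarrow> r = (k, l) \<or> s = (i, l)"
    "upright_right i \<Longrightarrow> r = (i, j) \<or> s = (i, l)"
    "flipped_right i \<Longrightarrow> r = (i, l) \<or> s = (i, j)"
    "upright_right k \<Longrightarrow> r = (k, j) \<or> s = (k, l)"
    "flipped_right k \<Longrightarrow> r = (k, l) \<or> s = (k, j)"
proof -
  have adj: "r = p \<or> s = q" if "rank_le_1 (M + unit_image i k j l)" "supported_at M p q"
      "rank_le_1 M" "M \<noteq> 0" for M p q
    using rank_le_1_add_supported_at[of M "unit_image i k j l" p q r s] that assms
    by (simp add: rank_le_1_unit_image)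
  note rank = rank_le_1_unit_image unit_image_nonzero rank_le_1_unit_image_add
  show "upright_left j \<Longrightarrow> r = (i, j) \<or> s = (k, j)"
    "flipped_left j \<Longrightarrow> r = (k, j) \<or> s = (i, j)"
    by (rule adj[of "unit_image i k j j"]; simp add: rank upright_left_def flipped_left_def)+
  show "upright_left l \<Longrightarrow> r = (i, l) \<or> s = (k, l)"
    "flipped_left l \<Longrightarrow> r = (k, l) \<or> s = (i, l)"
    by (rule adj[of "unit_image i k l l"]; simp add: rank upright_left_def flipped_left_def)+
  show "upright_right i \<Longrightarrow> r = (i, j) \<or> s = (i, l)"
    "flipped_right i \<Longrightarrow> r = (i, l) \<or> s = (i, j)"
    by (rule adj[of "unit_image i i j l"]; simp add: rank upright_right_def flipped_right_def)+
  show "upright_right k \<Longrightarrow> r = (k, j) \<or> s = (k, l)"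
    "flipped_right k \<Longrightarrow> r = (k, l) \<or> s = (k, j)"
    by (rule adj[of "unit_image k k j l"]; simp add: rank upright_right_def flipped_right_def)+
qed

text \<open>Opposite orientations at \<open>j\<close> and \<open>l\<close> leave only the positions
  ((i, j), (i, l)) and ((k, l), (k, j)) for the image. Either orientation of the second factor at
  \<open>k\<close> excludes the former, and at \<open>i\<close> the latter.\<close>

lemma left_orientation:
  assumes "i \<noteq> (k :: 'm)"
  shows "(\<forall>j. upright_left j) \<or> (\<forall>j. flipped_left j)"
proof (rule ccontr)
  assume "\<not> ?thesis"
  then obtain j l where jl: "upright_left j" "\<not> flipped_left j" "flipped_left l" "\<not> upright_left l"
    using left_cases by blast
  then have "j \<noteq> l"
    by auto
  obtain r s where "unit_image i k j l $ r $ s \<noteq> 0"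
    by (rule unit_image_nonzero_entry)
  from unit_image_entry_cases[OF this] show False
    using jl right_cases[of i] right_cases[of k] \<open>j \<noteq> l\<close> \<open>i \<noteq> k\<close> by auto
qed

lemma right_orientation:
  assumes "j \<noteq> (l :: 'n)"
  shows "(\<forall>i. upright_right i) \<or> (\<forall>i. flipped_right i)"
proof (rule ccontr)
  assume "\<not> ?thesis"
  then obtain i k where ik: "upright_right i" "\<not> flipped_right i" "flipped_right k" "\<not> upright_right k"
    using right_cases by blast
  then have "i \<noteq> k"
    by auto
  obtain r s where "unit_image i k j l $ r $ s \<noteq> 0"
    by (rule unit_image_nonzero_entry)
  from unit_image_entry_cases[OF this] show False
    using ik left_cases[of j] left_cases[of l] \<open>j \<noteq> l\<close> \<open>i \<noteq> k\<close> by auto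
qed

lemma upright_form:
  assumes left: "\<And>j. upright_left j" and right: "\<And>i. upright_right i"
  obtains U V where "unitary_matrix U" "unitary_matrix V" "\<forall>A B. F A B = U ** (A \<otimes>\<^sub>K B) ** V"
proof -
  have supp: "supported_at (unit_image i k j l) (i, j) (k, l)" for i k j l
  proof -
    have "r = (i, j) \<and> s = (k, l)" if "unit_image i k j l $ r $ s \<noteq> 0" for r s
    proof (cases "i = k \<or> j = l")
      case True
      then show ?thesis
        using left right that unfolding upright_left_def upright_right_def supported_at_def by blast
    next
      case False
      then show ?thesis
        using unit_image_entry_cases[OF that] left right by auto
    qed
    then show ?thesis
      by (simp add: supported_at_def)
  qed
  \<comment> \<open>Every position (p, q) belongs to exactly one pair of matrix units, so
    \<open>F\<close> multiplies the Kronecker product entrywise by \<nu>.\<close>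
  define \<nu> where "\<nu> p q = unit_image (fst p) (fst q) (snd p) (snd q) $ p $ q" for p q
  have unit: "unit_image i k j l = cmat_scale (\<nu> (i, j) (k, l)) (matrix_unit (i, j) (k, l))" for i k j l
    using supp[of i k j l] by (auto simp: vec_eq_iff cmat_scale_def \<nu>_def supported_at_def)
  have entry: "F A B $ p $ q = (A \<otimes>\<^sub>K B) $ p $ q * \<nu> p q" for A B p q
  proof -
    obtain i j k l where pq: "p = (i, j)" "q = (k, l)"
      by (metis surj_pair)
    have "F (matrix_unit i' k') B $ p $ q = (if i = i' \<and> k = k' then B $ j $ l * \<nu> p q else 0)" for i' k'
    proof -
      have "cmat_scale c (unit_image i' k' j' l') $ p $ q =
          (if j = j' \<and> l = l' then c * (if i = i' \<and> k = k' then \<nu> p q else 0) else 0)" for c j' l'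
        by (auto simp: unit cmat_scale_def pq)
      moreover have "F (matrix_unit i' k') B =
          (\<Sum>j\<in>UNIV. \<Sum>l\<in>UNIV. cmat_scale (B $ j $ l) (unit_image i' k' j l))"
        by (subst matrix_eq_sum_matrix_unit[of B]) (simp add: sum_right scale_right)
      ultimately have "F (matrix_unit i' k') B $ p $ q = (\<Sum>j'\<in>UNIV. \<Sum>l'\<in>UNIV.
          if j = j' \<and> l = l' then B $ j' $ l' * (if i = i' \<and> k = k' then \<nu> p q else 0) else 0)"
        by simp
      then show ?thesis
        by (simp add: sum_sum_delta)
    qed
    moreover have "F A B = (\<Sum>i\<in>UNIV. \<Sum>k\<in>UNIV. cmat_scale (A $ i $ k) (F (matrix_unit i k) B))"
      by (subst matrix_eq_sum_matrix_unit[of A]) (simp add: sum_left scale_left)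
    ultimately have "F A B $ p $ q = (\<Sum>i'\<in>UNIV. \<Sum>k'\<in>UNIV.
        if i = i' \<and> k = k' then A $ i' $ k' * (B $ j $ l * \<nu> p q) else 0)"
      by (simp add: cmat_scale_def if_distrib[of "(*) _"] cong: if_cong)
    also have "\<dots> = (A \<otimes>\<^sub>K B) $ p $ q * \<nu> p q"
      by (simp add: sum_sum_delta kron_def pq)
    finally show ?thesis .
  qed
  have unimodular: "cmod (\<nu> p q) = 1" for p q
    using spectral_norm[of "matrix_unit (fst p) (fst q)" "matrix_unit (snd p) (snd q)"]
    by (simp add: unit spectral_norm_cmat_scale)
  have minor: "\<nu> p q * \<nu> r s = \<nu> p s * \<nu> r q" for p q r s
  proof -
    \<comment> \<open>All-ones matrices are outer products, and the entries of their image are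
      precisely the coefficients \<nu>, which therefore have vanishing minors.\<close>
    let ?J = "F (outer (\<chi> i. 1) (\<chi> i. 1)) (outer (\<chi> i. 1) (\<chi> i. 1))"
    have "?J $ p $ q = \<nu> p q" for p q
      by (simp add: entry outer_def kron_def)
    moreover have "rank_le_1 ?J"
      by (rule rank_le_1_outer_outer)
    ultimately show ?thesis
      by (simp only: rank_le_1_def)
  qed
  have "\<nu> p p = 1" for p
    by (simp add: \<nu>_def diagonal)
  \<comment> \<open>The diagonal coefficient at the reference index \<open>undefined\<close> is 1,
    so the minor through it splits \<nu> into a row and a column factor.\<close>
  then have factor: "\<nu> p q = \<nu> p undefined * \<nu> undefined q" for p q
    using minor[of p q undefined undefined] by simp
  have "F A B = diagonal_matrix (\<lambda>p. \<nu> p undefined) ** (A \<otimes>\<^sub>K B) **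
      diagonal_matrix (\<lambda>q. \<nu> undefined q)" for A B
  proof -
    have "F A B $ p $ q = \<nu> p undefined * (A \<otimes>\<^sub>K B) $ p $ q * \<nu> undefined q" for p q
      unfolding entry by (subst factor) (simp only: mult_ac)
    then show ?thesis
      by (simp only: vec_eq_iff diagonal_matrix_mult_mult simp_thms)
  qed
  then have "\<forall>A B. F A B = diagonal_matrix (\<lambda>p. \<nu> p undefined) ** (A \<otimes>\<^sub>K B) **
      diagonal_matrix (\<lambda>q. \<nu> undefined q)"
    by (intro allI)
  with unimodular show thesis
    by (intro that[OF unitary_diagonal_matrix unitary_diagonal_matrix])
qed

end

section \<open>Removing the transpositions and the unitary factors\<close>

lemma (in diagonal_kron_isometry) transpose_left:
  "diagonal_kron_isometry (\<lambda>A. F (transpose A))"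
  by (intro diagonal_kron_isometry.intro diagonal_kron_isometry_axioms.intro
      kron_isometry_transpose_left) (simp add: diagonal)

lemma (in diagonal_kron_isometry) transpose_right:
  "diagonal_kron_isometry (\<lambda>A B. F A (transpose B))"
  by (intro diagonal_kron_isometry.intro diagonal_kron_isometry_axioms.intro
      kron_isometry_transpose_right) (simp add: diagonal)

lemma ex_upright_transpose:
  fixes F :: "complex^'m^'m \<Rightarrow> complex^'n^'n \<Rightarrow> complex^('m \<times> 'n)^('m \<times> 'n)"
  assumes "diagonal_kron_isometry F" and "i \<noteq> (k :: 'm)" and "j \<noteq> (l :: 'n)"
  obtains \<phi>\<^sub>1 \<phi>\<^sub>2 where "\<phi>\<^sub>1 = (\<lambda>X. X) \<or> \<phi>\<^sub>1 = transpose" "\<phi>\<^sub>2 = (\<lambda>X. X) \<or> \<phi>\<^sub>2 = transpose"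
    "diagonal_kron_isometry (\<lambda>A B. F (\<phi>\<^sub>1 A) (\<phi>\<^sub>2 B))"
    "\<forall>j. diagonal_kron_isometry.upright_left (\<lambda>A B. F (\<phi>\<^sub>1 A) (\<phi>\<^sub>2 B)) j"
    "\<forall>i. diagonal_kron_isometry.upright_right (\<lambda>A B. F (\<phi>\<^sub>1 A) (\<phi>\<^sub>2 B)) i"
proof -
  interpret F: diagonal_kron_isometry F
    by fact
  obtain \<phi>\<^sub>1 where 1: "\<phi>\<^sub>1 = (\<lambda>X. X) \<or> \<phi>\<^sub>1 = transpose"
    "diagonal_kron_isometry (\<lambda>A. F (\<phi>\<^sub>1 A))"
    "\<forall>j. diagonal_kron_isometry.upright_left (\<lambda>A. F (\<phi>\<^sub>1 A)) j"
  proof (cases "\<forall>j. F.upright_left j")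
    case True
    with assms(1) show thesis
      by (intro that[of "\<lambda>X. X"]) simp_all
  next
    case False
    interpret T: diagonal_kron_isometry "\<lambda>A. F (transpose A)"
      by (rule F.transpose_left)
    have "\<forall>j. F.flipped_left j"
      using F.left_orientation[OF assms(2)] False by blast
    then have "\<forall>j. T.upright_left j"
      by (simp add: F.flipped_left_def T.upright_left_def)
    with T.diagonal_kron_isometry_axioms show thesis
      by (intro that[of transpose]) simp_all
  qed
  interpret G: diagonal_kron_isometry "\<lambda>A. F (\<phi>\<^sub>1 A)"
    by fact
  show thesis
  proof (cases "\<forall>i. G.upright_right i")
    case True
    with 1 show thesis
      by (intro that[of \<phi>\<^sub>1 "\<lambda>X. X"]) simp_all
  next
    case False
    interpret T: diagonal_kron_isometry "\<lambda>A B. F (\<phi>\<^sub>1 A) (transpose B)"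
      by (rule G.transpose_right)
    have "\<forall>i. G.flipped_right i"
      using G.right_orientation[OF assms(3)] False by blast
    then have "\<forall>i. T.upright_right i"
      by (simp add: G.flipped_right_def T.upright_right_def)
    \<comment> \<open>The left orientation only involves diagonal units in the second argument,
      which transposition fixes.\<close>
    moreover have "\<forall>j. T.upright_left j"
      using 1(3) by (simp add: G.upright_left_def T.upright_left_def)
    ultimately show thesis
      using 1(1) T.diagonal_kron_isometry_axioms by (intro that[of \<phi>\<^sub>1 transpose]) simp_all
  qed
qed

lemma (in kron_isometry) ex_unitary_transpose_form:
  assumes "CARD('m) \<ge> 2" and "CARD('n) \<ge> 2"
  obtains U V \<phi>\<^sub>1 \<phi>\<^sub>2 where "unitary_matrix U" "unitary_matrix V"
    "\<phi>\<^sub>1 = (\<lambda>X. X) \<or> \<phi>\<^sub>1 = transpose" "\<phi>\<^sub>2 = (\<lambda>X. X) \<or> \<phi>\<^sub>2 = transpose"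
    "\<forall>A B. F A B = U ** (\<phi>\<^sub>1 A \<otimes>\<^sub>K \<phi>\<^sub>2 B) ** V"
proof -
  obtain i k :: 'm where ik: "i \<noteq> k"
    using assms(1) card_le_Suc0_iff_eq[of "UNIV :: 'm set"] by force
  obtain j l :: 'n where jl: "j \<noteq> l"
    using assms(2) card_le_Suc0_iff_eq[of "UNIV :: 'n set"] by force
  obtain Y X where YX: "unitary_matrix Y" "unitary_matrix X"
    "\<And>i j. F (matrix_unit i i) (matrix_unit j j) = Y ** matrix_unit (i, j) (i, j) ** X"
    using ex_unitary_diagonal_form by blast
  have cancel: "conj_transpose Y ** (Y ** M ** X) ** conj_transpose X = M"
    "Y ** (conj_transpose Y ** M ** conj_transpose X) ** X = M" for M
  proof -
    have "conj_transpose Y ** (Y ** M ** X) ** conj_transpose X =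
        (conj_transpose Y ** Y) ** M ** (X ** conj_transpose X)"
      "Y ** (conj_transpose Y ** M ** conj_transpose X) ** X =
        (Y ** conj_transpose Y) ** M ** (conj_transpose X ** X)"
      by (simp_all add: matrix_mul_assoc)
    with YX(1,2) show "conj_transpose Y ** (Y ** M ** X) ** conj_transpose X = M"
      "Y ** (conj_transpose Y ** M ** conj_transpose X) ** X = M"
      by (simp_all add: unitary_matrix_def)
  qed
  define G where "G A B = conj_transpose Y ** F A B ** conj_transpose X" for A B
  have "kron_isometry G"
    using kron_isometry_unitary[of "conj_transpose Y" "conj_transpose X" "mat 1" "mat 1" "mat 1" "mat 1"] YX
    by (simp add: unitary_matrix_conj_transpose unitary_matrix_mat_1 G_def[abs_def])
  then have "diagonal_kron_isometry G"
    by (intro diagonal_kron_isometry.intro diagonal_kron_isometry_axioms.intro)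
      (simp_all add: G_def YX(3) cancel)
  from this ik jl obtain \<phi>\<^sub>1 \<phi>\<^sub>2
    where \<phi>: "\<phi>\<^sub>1 = (\<lambda>X. X) \<or> \<phi>\<^sub>1 = transpose" "\<phi>\<^sub>2 = (\<lambda>X. X) \<or> \<phi>\<^sub>2 = transpose"
    and up: "diagonal_kron_isometry (\<lambda>A B. G (\<phi>\<^sub>1 A) (\<phi>\<^sub>2 B))"
    "\<forall>j. diagonal_kron_isometry.upright_left (\<lambda>A B. G (\<phi>\<^sub>1 A) (\<phi>\<^sub>2 B)) j"
    "\<forall>i. diagonal_kron_isometry.upright_right (\<lambda>A B. G (\<phi>\<^sub>1 A) (\<phi>\<^sub>2 B)) i"
    by (rule ex_upright_transpose)
  obtain U V where UV: "unitary_matrix U" "unitary_matrix V"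
    "\<forall>A B. G (\<phi>\<^sub>1 A) (\<phi>\<^sub>2 B) = U ** (A \<otimes>\<^sub>K B) ** V"
    by (rule diagonal_kron_isometry.upright_form[OF up(1) up(2)[rule_format] up(3)[rule_format]])
  \<comment> \<open>Both maps are involutions, so the upright form taken at the images of
    \<open>A\<close> and \<open>B\<close> gives back \<open>F A B\<close>.\<close>
  have \<phi>\<phi>: "\<phi>\<^sub>1 (\<phi>\<^sub>1 A) = A" "\<phi>\<^sub>2 (\<phi>\<^sub>2 B) = B" for A B
    using \<phi> by auto
  have F_eq: "F A B = (Y ** U) ** (\<phi>\<^sub>1 A \<otimes>\<^sub>K \<phi>\<^sub>2 B) ** (V ** X)" for A B
  proof -
    have "F A B = Y ** G (\<phi>\<^sub>1 (\<phi>\<^sub>1 A)) (\<phi>\<^sub>2 (\<phi>\<^sub>2 B)) ** X"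
      by (simp only: \<phi>\<phi> G_def cancel)
    then show ?thesis
      by (simp only: UV matrix_mul_assoc)
  qed
  show thesis
    by (rule that[OF unitary_matrix_mult[OF YX(1) UV(1)] unitary_matrix_mult[OF UV(2) YX(2)] \<phi>])
      (intro allI F_eq)
qed

section \<open>Return to linear maps on the Kronecker products\<close>

lemma kron_add_left: "(A + A') \<otimes>\<^sub>K B = A \<otimes>\<^sub>K B + A' \<otimes>\<^sub>K B"
  by (simp add: kron_def vec_eq_iff distrib_right)

lemma kron_add_right: "A \<otimes>\<^sub>K (B + B') = A \<otimes>\<^sub>K B + A \<otimes>\<^sub>K B'"
  by (simp add: kron_def vec_eq_iff distrib_left)

lemma kron_cmat_scale_left: "cmat_scale c A \<otimes>\<^sub>K B = cmat_scale c (A \<otimes>\<^sub>K B)"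
  by (simp add: kron_def cmat_scale_def vec_eq_iff mult_ac)

lemma kron_cmat_scale_right: "A \<otimes>\<^sub>K cmat_scale c B = cmat_scale c (A \<otimes>\<^sub>K B)"
  by (simp add: kron_def cmat_scale_def vec_eq_iff mult_ac)

lemma kron_isometryI:
  assumes "complex_linear \<phi>"
    and "\<And>A B. spectral_norm (\<phi> (A \<otimes>\<^sub>K B)) = spectral_norm (A \<otimes>\<^sub>K B)"
  shows "kron_isometry (\<lambda>A B. \<phi> (A \<otimes>\<^sub>K B))"
proof -
  have "\<phi> (A + B) = \<phi> A + \<phi> B" "\<phi> (cmat_scale c A) = cmat_scale c (\<phi> A)" for A B c
    using assms(1) by (simp_all add: complex_linear_iff)
  then show ?thesis
    by unfold_locales
      (simp_all add: assms(2) kron_add_left kron_add_right kron_cmat_scale_left kron_cmat_scale_right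
        spectral_norm_kron)
qed

theorem theorem2p1:
  fixes \<phi> :: "complex^('m::finite \<times> 'n::finite)^('m \<times> 'n) \<Rightarrow> complex^('m \<times> 'n)^('m \<times> 'n)"
  assumes "CARD('m) \<ge> 2" and "CARD('n) \<ge> 2"
    and "complex_linear \<phi>"
  shows "(\<forall>(A :: complex^'m^'m) (B :: complex^'n^'n).
            spectral_norm (\<phi> (A \<otimes>\<^sub>K B)) = spectral_norm (A \<otimes>\<^sub>K B))
    \<longleftrightarrow>
    (\<exists>(U :: complex^('m \<times> 'n)^('m \<times> 'n)) (V :: complex^('m \<times> 'n)^('m \<times> 'n))
        (\<phi>\<^sub>1 :: complex^'m^'m \<Rightarrow> complex^'m^'m) (\<phi>\<^sub>2 :: complex^'n^'n \<Rightarrow> complex^'n^'n).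
        unitary_matrix U \<and> unitary_matrix V \<and>
        (\<phi>\<^sub>1 = (\<lambda>X. X) \<or> \<phi>\<^sub>1 = transpose) \<and>
        (\<phi>\<^sub>2 = (\<lambda>X. X) \<or> \<phi>\<^sub>2 = transpose) \<and>
        (\<forall>A B. \<phi> (A \<otimes>\<^sub>K B) = U ** (\<phi>\<^sub>1 A \<otimes>\<^sub>K \<phi>\<^sub>2 B) ** V))"
    (is "?isometry \<longleftrightarrow> ?form")
proof
  assume ?isometry
  with assms(3) interpret kron_isometry "\<lambda>A B. \<phi> (A \<otimes>\<^sub>K B)"
    by (intro kron_isometryI) blast+
  obtain U V \<phi>\<^sub>1 \<phi>\<^sub>2 where "unitary_matrix U" "unitary_matrix V"
    "\<phi>\<^sub>1 = (\<lambda>X. X) \<or> \<phi>\<^sub>1 = transpose" "\<phi>\<^sub>2 = (\<lambda>X. X) \<or> \<phi>\<^sub>2 = transpose"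
    "\<forall>A B. \<phi> (A \<otimes>\<^sub>K B) = U ** (\<phi>\<^sub>1 A \<otimes>\<^sub>K \<phi>\<^sub>2 B) ** V"
    by (rule ex_unitary_transpose_form[OF assms(1,2)])
  then show ?form
    by blast
next
  assume ?form
  then show ?isometry
    by (auto simp: spectral_norm_unitary spectral_norm_kron spectral_norm_transpose)
qed

end
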